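(* Let $S_k$ denote the $k$-vertex star. For any fixed finite tree $T$ with at least $2$ vertices, $$\lim_{k\to\infty} \delta(S_k, T) = 1,$$ where $\delta(S,T) = \lim_{n\to\infty} \mathrm{TV}\left(\mathrm{UA}(n,S), \mathrm{UA}(n,T)\right)$.
   Context: Uniform attachment: for $n \ge k \ge 2$ and a tree $S$ on $k$ vertices (the seed), the random tree $\mathrm{UA}(n,S)$ is defined inductively by $\mathrm{UA}(k,S)=S$ and, given $\mathrm{UA}(n,S)$, the tree $\mathrm{UA}(n+1,S)$ is formed by adding a new vertex $u$ and a new edge $uv$, where $v$ is chosen uniformly at random among the vertices of $\mathrm{UA}(n,S)$, independently of all past choices. The trees are observed as unlabeled, unrooted trees: $\mathrm{UA}(n,S)$ is viewed as a random variable with values in the finite set of isomorphism classes of trees on $n$ vertices. For random variables $X,Y$ with values in a finite set $\mathcal{X}$ and laws $\mu,\nu$, $\mathrm{TV}(X,Y) = \frac12 \sum_{x\in\mathcal{X}} |\mu(x)-\nu(x)|$. The quantity $\mathrm{TV}(\mathrm{UA}(n,S),\mathrm{UA}(n,T))$ is defined for $n \ge \max\{|S|,|T|\}$ and is non-increasing in $n$, so the limit defining $\delta(S,T)$ exists. The $k$-vertex star is the tree with one vertex adjacent to all $k-1$ others. *)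

theory Defs
  imports
    "HOL-Probability.Probability_Mass_Function"
    "Graph_Theory.Graph_Theory"
begin

text \<open>
  A finite simple graph is a \<^locale>\<open>pair_graph\<close>: a symmetric loopfree digraph with a finite vertex
  set, in which an undirected edge is a pair of opposite arcs. In this encoding a pair of opposite
  arcs is already a (directed) cycle of length two, so the notion of a tree from
  \<^theory>\<open>Graph_Theory.Digraph_Component\<close> does not apply; only cycles of length at least three are
  cycles of the undirected graph. Connectedness includes nonemptiness of the vertex set.
\<close>

definition undirected_tree :: "'a pair_pre_digraph \<Rightarrow> bool" where
  "undirected_tree G \<longleftrightarrow>
     pair_graph G \<and> Digraph_Component.connected (with_proj G) \<and>
     \<not> (\<exists>p. pre_digraph.cycle (with_proj G) p \<and> 3 \<le> length p)"

definition star :: "nat \<Rightarrow> nat pair_pre_digraph" where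
  "star k = \<lparr>pverts = {..<k}, parcs = {0} \<times> {1..<k} \<union> {1..<k} \<times> {0}\<rparr>"

text \<open>
  Vertices are natural numbers, so that a fresh vertex is always available. Which fresh vertex is
  taken is immaterial, since the trees are only observed up to isomorphism.
\<close>

definition attach_leaf :: "nat pair_pre_digraph \<Rightarrow> nat \<Rightarrow> nat pair_pre_digraph" where
  "attach_leaf G v =
     (let u = Suc (Max (pverts G))
      in \<lparr>pverts = insert u (pverts G), parcs = {(u, v), (v, u)} \<union> parcs G\<rparr>)"

definition ua_step :: "nat pair_pre_digraph \<Rightarrow> nat pair_pre_digraph pmf" where
  "ua_step G = map_pmf (attach_leaf G) (pmf_of_set (pverts G))"

primrec ua_iter :: "nat \<Rightarrow> nat pair_pre_digraph \<Rightarrow> nat pair_pre_digraph pmf" where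
  "ua_iter 0 S = return_pmf S"
| "ua_iter (Suc m) S = bind_pmf (ua_iter m S) ua_step"

text \<open>The labelled tree with \<open>n\<close> vertices; meaningful only if \<open>n\<close> is at least the size of the seed.\<close>

definition ua_labelled :: "nat \<Rightarrow> nat pair_pre_digraph \<Rightarrow> nat pair_pre_digraph pmf" where
  "ua_labelled n S = ua_iter (n - card (pverts S)) S"

definition trees :: "nat \<Rightarrow> nat pair_pre_digraph set" where
  "trees n = {G. undirected_tree G \<and> card (pverts G) = n}"

definition tree_iso :: "nat pair_pre_digraph rel" where
  "tree_iso = {(G, H). undirected_tree G \<and> undirected_tree H \<and>
                       digraph_iso (with_proj G) (with_proj H)}"

definition unlabelled_trees :: "nat \<Rightarrow> nat pair_pre_digraph set set" where
  "unlabelled_trees n = trees n // tree_iso"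

definition UA :: "nat \<Rightarrow> nat pair_pre_digraph \<Rightarrow> nat pair_pre_digraph set pmf" where
  "UA n S = map_pmf (\<lambda>G. tree_iso `` {G}) (ua_labelled n S)"

definition TV :: "'a set \<Rightarrow> 'a pmf \<Rightarrow> 'a pmf \<Rightarrow> real" where
  "TV X p q = 1 / 2 * (\<Sum>x\<in>X. \<bar>pmf p x - pmf q x\<bar>)"

definition delta :: "nat pair_pre_digraph \<Rightarrow> nat pair_pre_digraph \<Rightarrow> real" where
  "delta S T = lim (\<lambda>n. TV (unlabelled_trees n) (UA n S) (UA n T))"

end

theory Submission
  imports Defs "HOL-Real_Asymp.Real_Asymp"
begin

text \<open>
  For a vertex \<open>v\<close> of a tree on \<open>n\<close> vertices let \<open>J v\<close> be the number of ordered pairs of vertices that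
  lie in a common component once \<open>v\<close> is deleted. Whether some \<open>v\<close> satisfies \<open>J v \<le> (e n)\<^sup>2\<close> depends only
  on the isomorphism class, and this event separates a large star from a fixed tree.

  For the centre of the star the expectation of \<open>J + n\<close> is multiplied by \<open>(n + 2) / n\<close> in each step, so
  it is of order \<open>n\<^sup>2 / k\<close>, and by Markov's inequality the event has probability at least
  \<open>1 - 4 / (k e\<^sup>2)\<close>. A fixed tree with \<open>m\<close> vertices splits into two connected sides, which stay connected
  when every new vertex joins the side of its parent. Deleting \<open>v\<close> leaves the side not containing \<open>v\<close>
  connected, so the event forces one of the sides to have at most \<open>e n\<close> vertices. The size of a
  side is a Polya urn whose law has point masses at most \<open>(m - 1) / (n - 1)\<close>, so the event has
  probability at most \<open>4 e m\<close>. Take \<open>e = k powr (- 1 / 3)\<close>.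

  Passing to isomorphism classes commutes with the attachment step, so the total variation distance
  decreases in \<open>n\<close> and the limit defining \<open>delta\<close> exists.
\<close>

subsection \<open>Trees and attached leaves\<close>

text \<open>Paths have to stay inside \<open>A\<close>, so this is connectivity of the induced
  subgraph. The empty set qualifies, hence nonemptiness is stated apart.\<close>

definition connected_on :: "'a rel \<Rightarrow> 'a set \<Rightarrow> bool" where
  "connected_on E A \<longleftrightarrow> (\<forall>x\<in>A. \<forall>y\<in>A. (x, y) \<in> (Restr E A)\<^sup>*)"

lemma connected_onD: "connected_on E A \<Longrightarrow> x \<in> A \<Longrightarrow> y \<in> A \<Longrightarrow> (x, y) \<in> (Restr E A)\<^sup>*"
  by (simp add: connected_on_def)

lemma connected_on_mono:
  assumes "connected_on E A" "E \<subseteq> F"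
  shows "connected_on F A"
  using assms rtrancl_mono[of "Restr E A" "Restr F A"] unfolding connected_on_def by blast

lemma connected_on_insert:
  assumes "connected_on E A" "w \<in> A" "(u, w) \<in> E" "(w, u) \<in> E"
  shows "connected_on E (insert u A)"
proof -
  let ?R = "(Restr E (insert u A))\<^sup>*"
  have sub: "(Restr E A)\<^sup>* \<subseteq> ?R"
    by (intro rtrancl_mono) auto
  \<comment> \<open>\<open>w\<close> serves as a hub: any two vertices are linked through
    it.\<close>
  have "(x, w) \<in> ?R \<and> (w, x) \<in> ?R" if "x \<in> insert u A" for x
  proof (cases "x = u")
    case True
    then show ?thesis using assms by auto
  next
    case False
    then show ?thesis using that assms sub by (auto dest: connected_onD)
  qed
  then show ?thesis
    unfolding connected_on_def by (meson rtrancl_trans)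
qed

text \<open>Arcs come in opposite pairs, so symmetrising the digraph changes nothing and
  connectivity is plain reachability along arcs.\<close>

lemma connected_pair_graph_iff:
  assumes "pair_graph G"
  shows "Digraph_Component.connected (with_proj G) \<longleftrightarrow> pverts G \<noteq> {} \<and> connected_on (parcs G) (pverts G)"
proof -
  interpret pair_graph G by fact
  have 1: "mk_symmetric (with_proj G) = G"
    unfolding mk_symmetric_def by (intro pair_pre_digraph.equality) (auto intro: arcs_symmetric)
  have 2: "Restr (parcs G) (pverts G) = parcs G"
    by (auto dest: in_arcsD1 in_arcsD2)
  have 3: "Digraph.reachable (with_proj G) x y \<longleftrightarrow> (x, y) \<in> (parcs G)\<^sup>*"
    if x: "x \<in> pverts G" for x y
  proof
    show "(x, y) \<in> (parcs G)\<^sup>*" if "Digraph.reachable (with_proj G) x y"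
      using reachable_rtranclI[OF that] by simp
    show "Digraph.reachable (with_proj G) x y" if "(x, y) \<in> (parcs G)\<^sup>*"
      using that
    proof induction
      case base
      then show ?case using x by simp
    next
      case (step y z)
      then show ?case using reachable_adj_trans[of x y z] by simp
    qed
  qed
  show ?thesis
    by (simp add: Digraph_Component.connected_def strongly_connected_def connected_on_def 1 2 3)
qed

lemma pair_graph_iff:
  "pair_graph G \<longleftrightarrow> finite (pverts G) \<and> parcs G \<subseteq> pverts G \<times> pverts G \<and> sym (parcs G) \<and> irrefl (parcs G)"
proof
  assume "pair_graph G"
  then interpret pair_graph G .
  show "finite (pverts G) \<and> parcs G \<subseteq> pverts G \<times> pverts G \<and> sym (parcs G) \<and> irrefl (parcs G)"
    using in_arcsD1 in_arcsD2 by (auto simp: sym_def irrefl_def intro: arcs_symmetric dest: no_loops')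
next
  assume *: "finite (pverts G) \<and> parcs G \<subseteq> pverts G \<times> pverts G \<and> sym (parcs G) \<and> irrefl (parcs G)"
  then have "finite (parcs G)" by (auto intro: finite_subset)
  with * show "pair_graph G"
    by unfold_locales (auto simp: symmetric_def irrefl_def)
qed

lemma undirected_treeD:
  assumes "undirected_tree G"
  shows "finite (pverts G)" "pverts G \<noteq> {}" "parcs G \<subseteq> pverts G \<times> pverts G" "sym (parcs G)"
    "irrefl (parcs G)" "connected_on (parcs G) (pverts G)"
proof -
  have 1: "pair_graph G" "Digraph_Component.connected (with_proj G)"
    using assms by (simp_all add: undirected_tree_def)
  show "finite (pverts G)" "parcs G \<subseteq> pverts G \<times> pverts G" "sym (parcs G)" "irrefl (parcs G)"
    using 1(1) unfolding pair_graph_iff by simp_all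
  show "pverts G \<noteq> {}" "connected_on (parcs G) (pverts G)"
    using 1(2) unfolding connected_pair_graph_iff[OF 1(1)] by simp_all
qed

section \<open>Cycles as closed lists of arcs\<close>

lemma cycle_with_proj_iff:
  "pre_digraph.cycle (with_proj G) p \<longleftrightarrow>
     (\<exists>x\<in>pverts G. set p \<subseteq> parcs G \<and> pcas x p x \<and> distinct (map snd p) \<and> p \<noteq> [])"
proof -
  interpret pair_pre_digraph G .
  \<comment> \<open>The vertices visited after the start are the heads of the arcs.\<close>
  have "tl (pawalk_verts x p) = map snd p" if "pcas x p x" for x
    using awalk_verts_conv'[of x p x] that by (auto split: if_splits)
  then show ?thesis
    unfolding cycle_def awalk_def by auto
qed

text \<open>Every inner vertex of a walk is the head of one arc and the tail of the next. For a
  closed walk heads and tails therefore agree as multisets, so distinct heads force distinct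
  tails.\<close>

lemma pcas_mset:
  assumes "pcas x p y"
  shows "add_mset y (mset (map fst p)) = add_mset x (mset (map snd p))"
  using assms
proof (induction p arbitrary: x)
  case (Cons e p)
  then have "add_mset y (mset (map fst p)) = add_mset (snd e) (mset (map snd p))" "fst e = x"
    by auto
  then show ?case by (simp add: add_mset_commute)
qed simp

text \<open>\<open>C\<close> holds all arcs of the walk that leave \<open>x\<close> and is closed
  under passing to a successor arc, so the walk never gets out of it.\<close>

lemma pcas_closed_from_start:
  assumes "pcas x p y" "\<forall>b\<in>set p. fst b = x \<longrightarrow> b \<in> C"
    "\<forall>a\<in>C. \<forall>b\<in>set p. fst b = snd a \<longrightarrow> b \<in> C"
  shows "set p \<subseteq> C"
  using assms
proof (induction p arbitrary: x)
  case (Cons e p)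
  have "fst e = x" and walk: "pcas (snd e) p y" using Cons.prems(1) by simp_all
  then have e: "e \<in> C" using Cons.prems(2) bspec[OF Cons.prems(2), of e] by (simp only: list.set insertI1)
  have "set p \<subseteq> C"
  proof (rule Cons.IH[OF walk])
    show "\<forall>b\<in>set p. fst b = snd e \<longrightarrow> b \<in> C"
      using Cons.prems(3) e by (meson list.set_intros(2))
    show "\<forall>a\<in>C. \<forall>b\<in>set p. fst b = snd a \<longrightarrow> b \<in> C"
      using Cons.prems(3) by (meson list.set_intros(2))
  qed
  then show ?case using e by (simp only: list.set insert_subset)
qed simp

text \<open>Once an arc of the walk lies in \<open>C\<close>, all later ones do; the last of them
  ends in \<open>y\<close>.\<close>

lemma pcas_closed_end:
  assumes "pcas x p y" "a \<in> set p" "a \<in> C"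
    "\<forall>a\<in>C. \<forall>b\<in>set p. fst b = snd a \<longrightarrow> b \<in> C"
  shows "\<exists>c\<in>C. snd c = y"
  using assms
proof (induction p arbitrary: x a)
  case (Cons e p)
  show ?case
  proof (cases p)
    case Nil
    then show ?thesis using Cons.prems by auto
  next
    case p: (Cons e' p')
    have "\<exists>a'\<in>set p. a' \<in> C"
    proof (cases "a = e")
      case True
      then have "e' \<in> C" using Cons.prems p by simp
      then show ?thesis using p by simp
    next
      case False
      then have "a \<in> set p" using Cons.prems(2) by simp
      then show ?thesis using Cons.prems(3) by blast
    qed
    then obtain a' where a': "a' \<in> set p" "a' \<in> C" by blast
    show ?thesis
    proof (rule Cons.IH[OF _ a'])
      show "pcas (snd e) p y" using Cons.prems(1) by simp
      show "\<forall>a\<in>C. \<forall>b\<in>set p. fst b = snd a \<longrightarrow> b \<in> C" using Cons.prems(4) by simp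
    qed
  qed
qed simp

text \<open>The last arc lies in \<open>C\<close> and leads back to \<open>x\<close>, so the first
  arc follows it cyclically and the whole walk is caught.\<close>

lemma closed_walk_closed:
  assumes "pcas x p x" "a \<in> set p" "a \<in> C"
    "\<forall>a\<in>C. \<forall>b\<in>set p. fst b = snd a \<longrightarrow> b \<in> C"
  shows "set p \<subseteq> C"
proof (rule pcas_closed_from_start[OF assms(1) _ assms(4)])
  show "\<forall>b\<in>set p. fst b = x \<longrightarrow> b \<in> C"
    using pcas_closed_end[OF assms] assms(4) by auto
qed

text \<open>The arc into a leaf \<open>u\<close> must be followed by its opposite, which must be followed by the
  former again, so a cycle through \<open>u\<close> consists of these two arcs only.\<close>

lemma cycle_through_leaf:
  assumes "pcas x p x" "distinct (map snd p)" "a \<in> set p" "fst a = u \<or> snd a = u"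
    and leaf: "\<And>b. b \<in> set p \<Longrightarrow> fst b = u \<Longrightarrow> b = (u, w)" "\<And>b. b \<in> set p \<Longrightarrow> snd b = u \<Longrightarrow> b = (w, u)"
  shows "length p \<le> 2"
proof -
  have mset: "mset (map fst p) = mset (map snd p)"
    using pcas_mset[OF assms(1)] by simp
  then have "distinct (map fst p)" using assms(2) by (metis mset_eq_imp_distinct_iff)
  then have inj: "inj_on fst (set p)" by (simp add: distinct_map)
  have "fst ` set p = snd ` set p" using mset_eq_setD[OF mset] by simp
  then have "u \<in> snd ` set p" using assms(3,4) by force
  then have wu: "(w, u) \<in> set p" using leaf(2) by force
  have "set p \<subseteq> {(w, u), (u, w)}"
  proof (rule closed_walk_closed[OF assms(1) wu])
    have "b = (w, u)" if "b \<in> set p" "fst b = w" for b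
      using inj_onD[OF inj _ that(1) wu] that(2) by simp
    then show "\<forall>a\<in>{(w, u), (u, w)}. \<forall>b\<in>set p. fst b = snd a \<longrightarrow> b \<in> {(w, u), (u, w)}"
      using leaf(1) by (metis insert_iff singletonD snd_conv)
  qed simp
  moreover have "distinct p" using assms(2) by (simp add: distinct_map)
  ultimately have "length p \<le> card {(w, u), (u, w)}"
    by (metis card_mono distinct_card finite.emptyI finite.insertI)
  also have "\<dots> \<le> 2" using card_insert_le_m1[of 2 "{(u, w)}" "(w, u)"] by simp
  finally show ?thesis .
qed

section \<open>Leaf attachment preserves trees\<close>

lemma Suc_Max_notin: "finite A \<Longrightarrow> Suc (Max A) \<notin> A"
  using Max_ge Suc_n_not_le_n by blast

lemma attach_leaf_simps:
  "pverts (attach_leaf G v) = insert (Suc (Max (pverts G))) (pverts G)"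
  "parcs (attach_leaf G v) = {(Suc (Max (pverts G)), v), (v, Suc (Max (pverts G)))} \<union> parcs G"
  by (simp_all add: attach_leaf_def Let_def)

text \<open>A cycle of length at least three avoids the new leaf and hence is a cycle of
  \<open>G\<close> already; connectivity extends through the new edge.\<close>

lemma undirected_tree_attach_leaf:
  assumes G: "undirected_tree G" and v: "v \<in> pverts G"
  shows "undirected_tree (attach_leaf G v)"
proof -
  define u where "u = Suc (Max (pverts G))"
  define G' where "G' = attach_leaf G v"
  have V: "pverts G' = insert u (pverts G)" and E: "parcs G' = {(u, v), (v, u)} \<union> parcs G"
    by (simp_all add: G'_def u_def attach_leaf_simps)
  note D = undirected_treeD[OF G]
  have u: "u \<notin> pverts G" unfolding u_def by (rule Suc_Max_notin[OF D(1)])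
  have uv: "u \<noteq> v" using u v by auto
  have pg: "pair_graph G'"
    unfolding pair_graph_iff V E using D v uv by (auto simp: sym_def irrefl_def)
  have "connected_on (parcs G') (pverts G')"
    unfolding V by (rule connected_on_insert[OF connected_on_mono[OF D(6)] v]) (auto simp: E)
  then have conn: "Digraph_Component.connected (with_proj G')"
    unfolding connected_pair_graph_iff[OF pg] by (auto simp: V)
  have "\<not> 3 \<le> length p" if cyc: "pre_digraph.cycle (with_proj G') p" for p
  proof
    assume len: "3 \<le> length p"
    from cyc obtain x where x: "set p \<subseteq> parcs G'" "pcas x p x" "distinct (map snd p)" "p \<noteq> []"
      unfolding cycle_with_proj_iff by auto
    have nu: "\<not> (fst a = u \<or> snd a = u)" if "a \<in> set p" for a
    proof
      assume "fst a = u \<or> snd a = u"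
      with x(2,3) \<open>a \<in> set p\<close> have "length p \<le> 2"
      proof (rule cycle_through_leaf)
        show "b = (u, v)" if "b \<in> set p" "fst b = u" for b
          using that subsetD[OF x(1) that(1)] u D(3) uv unfolding E by (metis SigmaD1 SigmaD2 UnE insertE prod.collapse singletonD fst_conv snd_conv subsetD)
        show "b = (v, u)" if "b \<in> set p" "snd b = u" for b
          using that subsetD[OF x(1) that(1)] u D(3) uv unfolding E by (metis SigmaD1 SigmaD2 UnE insertE prod.collapse singletonD fst_conv snd_conv subsetD)
      qed
      then show False using len by simp
    qed
    have sub: "set p \<subseteq> parcs G"
    proof
      fix a assume a: "a \<in> set p"
      show "a \<in> parcs G" using subsetD[OF x(1) a] nu[OF a] unfolding E by auto
    qed
    have "fst (hd p) = x" "hd p \<in> set p" using x(2,4) by (cases p; simp)+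
    then have "x \<in> pverts G" using sub D(3) by fastforce
    then have "pre_digraph.cycle (with_proj G) p"
      unfolding cycle_with_proj_iff using x sub by auto
    then show False using G len unfolding undirected_tree_def by auto
  qed
  then show ?thesis
    using pg conn unfolding undirected_tree_def G'_def by auto
qed

text \<open>Attaching a leaf at the centre \<open>0\<close> of \<open>star k\<close> gives
  \<open>star (Suc k)\<close>, because the fresh label is then exactly \<open>k\<close>.\<close>

lemma undirected_tree_star:
  assumes "1 \<le> k"
  shows "undirected_tree (star k)"
  using assms
proof (induction k rule: dec_induct)
  case base
  have 1: "star (Suc 0) = \<lparr>pverts = {0}, parcs = {}\<rparr>"
    by (auto simp: star_def)
  have pg: "pair_graph (star (Suc 0))"
    unfolding pair_graph_iff 1 by (auto simp: sym_def irrefl_def)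
  then have "Digraph_Component.connected (with_proj (star (Suc 0)))"
    unfolding connected_pair_graph_iff[OF pg] by (simp add: connected_on_def 1)
  moreover have "\<not> pre_digraph.cycle (with_proj (star (Suc 0))) p" for p
    unfolding cycle_with_proj_iff 1 by auto
  ultimately show ?case
    using pg by (simp add: undirected_tree_def)
next
  case (step k)
  have "Max {..<k} = k - 1" using step(1)
    by (intro Max_eqI) auto
  then have "star (Suc k) = attach_leaf (star k) 0"
    using step(1) by (auto simp: star_def attach_leaf_def lessThan_Suc)
  then show ?case
    using undirected_tree_attach_leaf[OF step.IH, of 0] step(1) by (auto simp: star_def)
qed

subsection \<open>Isomorphisms\<close>

text \<open>An arc is the pair of its end points, so the map on arcs is forced by the map
  \<open>h\<close> on vertices.\<close>

lemma digraph_iso_with_proj_iff: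
  "digraph_iso (with_proj G) (with_proj H) \<longleftrightarrow> pair_wf_digraph G \<and>
     (\<exists>h. inj_on h (pverts G) \<and> pverts H = h ` pverts G \<and> parcs H = map_prod h h ` parcs G)"
    (is "_ \<longleftrightarrow> ?R")
proof
  assume "digraph_iso (with_proj G) (with_proj H)"
  then obtain f where f: "pre_digraph.digraph_isomorphism (with_proj G) f" "with_proj H = app_iso f (with_proj G)"
    unfolding digraph_iso_def by blast
  have eq: "pverts H = iso_verts f ` pverts G" "parcs H = iso_arcs f ` parcs G" "iso_tail f = fst" "iso_head f = snd"
    using arg_cong[OF f(2), of verts] arg_cong[OF f(2), of arcs] arg_cong[OF f(2), of tail]
      arg_cong[OF f(2), of head] by simp_all
  have "iso_arcs f a = map_prod (iso_verts f) (iso_verts f) a" if "a \<in> parcs G" for a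
    using f(1) that eq(3,4) by (auto simp: pre_digraph.digraph_isomorphism_def prod_eq_iff)
  then have "parcs H = map_prod (iso_verts f) (iso_verts f) ` parcs G"
    unfolding eq(2) by (rule image_cong[OF refl])
  then show ?R
    using f(1) eq(1) by (auto simp: pre_digraph.digraph_isomorphism_def wf_digraph_wp_iff)
next
  assume ?R
  then obtain h where wf: "pair_wf_digraph G" and h: "inj_on h (pverts G)" "pverts H = h ` pverts G"
    "parcs H = map_prod h h ` parcs G" by blast
  interpret pair_wf_digraph G by fact
  define f where "f = \<lparr>iso_verts = h, iso_arcs = map_prod h h, iso_head = snd, iso_tail = fst\<rparr>"
  have "inj_on (map_prod h h) (parcs G)"
    by (rule inj_on_subset[OF map_prod_inj_on[OF h(1) h(1)]]) (auto dest: in_arcsD1 in_arcsD2)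
  then have "pre_digraph.digraph_isomorphism (with_proj G) f"
    using h(1) wf by (auto simp: pre_digraph.digraph_isomorphism_def f_def wf_digraph_wp_iff)
  moreover have "with_proj H = app_iso f (with_proj G)"
    by (simp add: with_proj_def app_iso_def f_def h)
  ultimately show "digraph_iso (with_proj G) (with_proj H)"
    unfolding digraph_iso_def by blast
qed

lemma undirected_tree_imp_wf: "undirected_tree G \<Longrightarrow> pair_wf_digraph G"
  by (simp add: undirected_tree_def pair_graph_def pair_digraph_def pair_fin_digraph_def)

text \<open>Isomorphic copies are written as images under a vertex map, so that isomorphisms compose
  and invert as functions.\<close>

definition graph_map :: "('a \<Rightarrow> 'b) \<Rightarrow> 'a pair_pre_digraph \<Rightarrow> 'b pair_pre_digraph" where
  "graph_map h G = \<lparr>pverts = h ` pverts G, parcs = map_prod h h ` parcs G\<rparr>"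

lemma digraph_iso_graph_map:
  "pair_wf_digraph G \<Longrightarrow> inj_on h (pverts G) \<Longrightarrow> digraph_iso (with_proj G) (with_proj (graph_map h G))"
  unfolding digraph_iso_with_proj_iff by (auto simp: graph_map_def)

lemma digraph_isoE:
  assumes "digraph_iso (with_proj G) (with_proj H)"
  obtains h where "inj_on h (pverts G)" "H = graph_map h G"
proof -
  from assms obtain h where "inj_on h (pverts G)" "pverts H = h ` pverts G" "parcs H = map_prod h h ` parcs G"
    unfolding digraph_iso_with_proj_iff by blast
  then show ?thesis using that[of h] by (simp add: graph_map_def)
qed

lemma graph_map_comp: "graph_map g (graph_map h G) = graph_map (g \<circ> h) G"
  by (simp add: graph_map_def image_comp map_prod_compose)

lemma graph_map_cong:
  assumes "pair_wf_digraph G" "\<And>x. x \<in> pverts G \<Longrightarrow> g x = h x"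
  shows "graph_map g G = graph_map h G"
proof -
  interpret pair_wf_digraph G by fact
  have "map_prod g g ` parcs G = map_prod h h ` parcs G"
  proof (rule image_cong)
    show "map_prod g g e = map_prod h h e" if "e \<in> parcs G" for e
      using assms(2)[OF arc_fst_in_verts[OF that]] assms(2)[OF arc_snd_in_verts[OF that]]
      by (simp add: prod_eq_iff)
  qed simp
  then show ?thesis using assms(2) by (simp add: graph_map_def)
qed

lemma graph_map_id: "graph_map id G = G"
  by (simp add: graph_map_def prod.map_id0)

lemma digraph_iso_wf:
  assumes "digraph_iso (with_proj G) (with_proj H)"
  shows "pair_wf_digraph G"
  using assms by (simp add: digraph_iso_with_proj_iff)

lemma digraph_iso_refl: "pair_wf_digraph G \<Longrightarrow> digraph_iso (with_proj G) (with_proj G)"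
  using digraph_iso_graph_map[of G id] by (simp add: graph_map_id)

lemma digraph_iso_sym:
  assumes "digraph_iso (with_proj G) (with_proj H)" "pair_wf_digraph H"
  shows "digraph_iso (with_proj H) (with_proj G)"
proof -
  obtain h where h: "inj_on h (pverts G)" "H = graph_map h G"
    using assms(1) by (rule digraph_isoE)
  let ?g = "the_inv_into (pverts G) h"
  have "graph_map ?g H = graph_map id G"
    unfolding h(2) graph_map_comp
    by (rule graph_map_cong[OF digraph_iso_wf[OF assms(1)]]) (simp add: the_inv_into_f_f[OF h(1)])
  moreover have "inj_on ?g (pverts H)"
    using inj_on_the_inv_into[OF h(1)] by (simp add: h(2) graph_map_def)
  ultimately show ?thesis
    using digraph_iso_graph_map[OF assms(2), of ?g] by (simp add: graph_map_id)
qed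

lemma digraph_iso_trans:
  assumes "digraph_iso (with_proj G) (with_proj H)" "digraph_iso (with_proj H) (with_proj K)"
  shows "digraph_iso (with_proj G) (with_proj K)"
proof -
  obtain h where h: "inj_on h (pverts G)" "H = graph_map h G"
    using assms(1) by (rule digraph_isoE)
  obtain g where g: "inj_on g (pverts H)" "K = graph_map g H"
    using assms(2) by (rule digraph_isoE)
  have "inj_on (g \<circ> h) (pverts G)"
    using comp_inj_on[OF h(1)] g(1) by (simp add: h(2) graph_map_def)
  then show ?thesis
    using digraph_iso_graph_map[OF digraph_iso_wf[OF assms(1)]] by (simp add: g(2) h(2) graph_map_comp)
qed

lemma tree_iso_iff:
  "(G, H) \<in> tree_iso \<longleftrightarrow> undirected_tree G \<and> undirected_tree H \<and> digraph_iso (with_proj G) (with_proj H)"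
  by (simp add: tree_iso_def)

lemma equiv_tree_iso: "equiv {G. undirected_tree G} tree_iso"
proof (rule equivI)
  show "refl_on {G. undirected_tree G} tree_iso"
    by (auto simp: refl_on_def tree_iso_iff intro: digraph_iso_refl undirected_tree_imp_wf)
  show "sym tree_iso"
    by (auto simp: sym_def tree_iso_iff intro: digraph_iso_sym undirected_tree_imp_wf)
  show "trans tree_iso"
    unfolding trans_def tree_iso_iff by (meson digraph_iso_trans)
  show "tree_iso \<subseteq> {G. undirected_tree G} \<times> {G. undirected_tree G}"
    by (auto simp: tree_iso_iff)
qed

lemma tree_iso_class_eq: "(G, H) \<in> tree_iso \<Longrightarrow> tree_iso `` {G} = tree_iso `` {H}"
  using equiv_class_eq[OF equiv_tree_iso] .

lemma tree_iso_self: "undirected_tree G \<Longrightarrow> (G, G) \<in> tree_iso"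
  by (auto simp: tree_iso_iff intro: digraph_iso_refl undirected_tree_imp_wf)

lemma attach_leaf_iso:
  assumes iso: "(G, graph_map h G) \<in> tree_iso" and h: "inj_on h (pverts G)" and v: "v \<in> pverts G"
  shows "(attach_leaf G v, attach_leaf (graph_map h G) (h v)) \<in> tree_iso"
proof -
  let ?u = "Suc (Max (pverts G))" and ?u' = "Suc (Max (h ` pverts G))"
  \<comment> \<open>The isomorphism is extended by sending the fresh vertex of \<open>G\<close> to
    the fresh vertex of the copy.\<close>
  define g where "g = h(?u := ?u')"
  have tree: "undirected_tree G" "undirected_tree (graph_map h G)"
    using iso by (auto simp: tree_iso_iff)
  note D = undirected_treeD[OF tree(1)]
  have u: "?u \<notin> pverts G" "?u' \<notin> h ` pverts G"
    using D(1) by (auto intro!: Suc_Max_notin simp del: image_iff)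
  have gh: "g x = h x" if "x \<in> pverts G" for x using that u(1) by (auto simp: g_def)
  have gu: "g ?u = ?u'" by (simp add: g_def)
  have inj: "inj_on g (pverts (attach_leaf G v))"
    using h u(1,2) inj_on_cong[of "pverts G" g h, OF gh] image_cong[OF refl gh, of "pverts G"]
    by (simp add: attach_leaf_simps gu)
  have "map_prod g g ` parcs G = map_prod h h ` parcs G"
    using D(3) by (intro image_cong) (auto simp: gh)
  then have "graph_map g (attach_leaf G v) = attach_leaf (graph_map h G) (h v)"
    using v by (simp add: graph_map_def attach_leaf_def Let_def gh gu cong: image_cong)
  moreover have "undirected_tree (attach_leaf G v)"
    by (rule undirected_tree_attach_leaf[OF tree(1) v])
  moreover have "undirected_tree (attach_leaf (graph_map h G) (h v))"
    using undirected_tree_attach_leaf[OF tree(2)] v by (simp add: graph_map_def)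
  ultimately show ?thesis
    using digraph_iso_graph_map[OF undirected_tree_imp_wf inj] by (simp add: tree_iso_iff)
qed

text \<open>Labels are arbitrary naturals, but a class is determined by \<open>copies\<close>, the
  isomorphic graphs with labels below \<open>n\<close>, and these sets are subsets of the finite set
  \<open>F\<close>.\<close>

lemma finite_unlabelled_trees: "finite (unlabelled_trees n)"
proof -
  define F where "F = {G :: nat pair_pre_digraph. pverts G \<subseteq> {..<n} \<and> parcs G \<subseteq> {..<n} \<times> {..<n}}"
  define copies where "copies G = {H \<in> F. digraph_iso (with_proj G) (with_proj H)}"
    for G :: "nat pair_pre_digraph"
  have "F \<subseteq> (\<lambda>(V, E). \<lparr>pverts = V, parcs = E\<rparr>) ` (Pow {..<n} \<times> Pow ({..<n} \<times> {..<n}))"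
  proof
    fix G assume "G \<in> F"
    then show "G \<in> (\<lambda>(V, E). \<lparr>pverts = V, parcs = E\<rparr>) ` (Pow {..<n} \<times> Pow ({..<n} \<times> {..<n}))"
      by (intro image_eqI[of _ _ "(pverts G, parcs G)"]) (auto simp: F_def)
  qed
  then have "finite F" by (rule finite_subset) auto
  have key: "(G, H) \<in> tree_iso" if G: "G \<in> trees n" and H: "H \<in> trees n" and eq: "copies G = copies H" for G H
  proof -
    have tree: "undirected_tree G" "undirected_tree H" using G H by (auto simp: trees_def)
    note D = undirected_treeD[OF tree(1)]
    \<comment> \<open>Relabelling by \<open>0\<close> to \<open>n - 1\<close> shows that
      \<open>copies G\<close> is nonempty; a common copy then links \<open>G\<close> to
      \<open>H\<close>.\<close>
    have "\<exists>h. bij_betw h (pverts G) {..<n}"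
      using D(1) G by (simp add: trees_def ex_bij_betw_finite_nat finite_same_card_bij)
    then obtain h where h: "bij_betw h (pverts G) {..<n}" by blast
    have "graph_map h G \<in> F"
      using h D(3) by (auto simp: F_def graph_map_def bij_betw_def)
    then have "graph_map h G \<in> copies G"
      using digraph_iso_graph_map[OF undirected_tree_imp_wf[OF tree(1)]] h
      by (auto simp: copies_def bij_betw_def)
    then have G': "digraph_iso (with_proj G) (with_proj (graph_map h G))"
      "digraph_iso (with_proj H) (with_proj (graph_map h G))"
      using eq by (auto simp: copies_def)
    have "pair_wf_digraph (graph_map h G)"
      using D(3) by unfold_locales (auto simp: graph_map_def)
    then show ?thesis
      using G' tree by (auto simp: tree_iso_iff intro: digraph_iso_trans digraph_iso_sym)
  qed
  have "finite (copies ` trees n)"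
    by (rule finite_subset[of _ "Pow F"]) (auto simp: copies_def \<open>finite F\<close>)
  moreover have "unlabelled_trees n = (\<lambda>c. tree_iso `` {SOME G. G \<in> trees n \<and> copies G = c}) ` copies ` trees n"
  proof -
    have "tree_iso `` {SOME H. H \<in> trees n \<and> copies H = copies G} = tree_iso `` {G}" if "G \<in> trees n" for G
    proof -
      have "(SOME H. H \<in> trees n \<and> copies H = copies G) \<in> trees n \<and>
          copies (SOME H. H \<in> trees n \<and> copies H = copies G) = copies G"
        by (rule someI[of _ G]) (simp add: that)
      then show ?thesis using that by (intro tree_iso_class_eq key) auto
    qed
    then show ?thesis
      by (auto simp: unlabelled_trees_def quotient_def image_image)
  qed
  ultimately show ?thesis by simp
qed

subsection \<open>Pairs joined after deleting a vertex\<close>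

text \<open>For a tree this is the equivalence of lying in one component after deleting
  \<open>v\<close>, so its cardinality is the sum of the squared component sizes.\<close>

definition joined :: "'a pair_pre_digraph \<Rightarrow> 'a \<Rightarrow> 'a rel" where
  "joined G v = {(x, y). x \<in> pverts G - {v} \<and> y \<in> pverts G - {v} \<and> (x, y) \<in> (Restr (parcs G) (- {v}))\<^sup>*}"

lemma joined_subset: "joined G v \<subseteq> pverts G \<times> pverts G"
  by (auto simp: joined_def)

lemma finite_joined: "finite (pverts G) \<Longrightarrow> finite (joined G v)"
  by (rule finite_subset[OF joined_subset]) simp

text \<open>Paths avoiding \<open>v\<close> map to paths avoiding \<open>h v\<close> because
  \<open>h\<close> is injective. Isomorphism is symmetric, so one inequality yields
  invariance.\<close>

lemma card_joined_graph_map: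
  assumes "pair_wf_digraph G" "finite (pverts G)" "inj_on h (pverts G)" "v \<in> pverts G"
  shows "card (joined G v) \<le> card (joined (graph_map h G) (h v))"
proof -
  interpret pair_wf_digraph G by fact
  have neq: "h x \<noteq> h v" if "x \<in> pverts G" "x \<noteq> v" for x
    using that assms(3,4) by (auto dest: inj_onD)
  have "(h x, h y) \<in> (Restr (parcs (graph_map h G)) (- {h v}))\<^sup>*" if "(x, y) \<in> (Restr (parcs G) (- {v}))\<^sup>*" for x y
    using that
  proof induction
    case (step y z)
    then have "(h y, h z) \<in> Restr (parcs (graph_map h G)) (- {h v})"
      using neq in_arcsD1 in_arcsD2 by (auto simp: graph_map_def)
    with step.IH show ?case by (rule rtrancl_into_rtrancl)
  qed simp
  then have "map_prod h h ` joined G v \<subseteq> joined (graph_map h G) (h v)"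
    using neq by (auto simp: joined_def graph_map_def)
  moreover have "card (map_prod h h ` joined G v) = card (joined G v)"
    by (rule card_image[OF inj_on_subset[OF map_prod_inj_on[OF assms(3,3)] joined_subset]])
  moreover have "finite (joined (graph_map h G) (h v))"
    by (rule finite_joined) (simp add: graph_map_def assms(2))
  ultimately show ?thesis by (metis card_mono)
qed

text \<open>Contracting the new leaf to its parent \<open>w\<close> turns paths of the larger tree
  into paths of \<open>G\<close>. A new pair is thus the leaf with itself, or the leaf and a vertex
  joined to \<open>w\<close>, in either order.\<close>

lemma card_joined_attach_leaf:
  assumes G: "undirected_tree G" and v: "v \<in> pverts G" and w: "w \<in> pverts G"
  shows "card (joined (attach_leaf G w) v) \<le>
    card (joined G v) + card (joined G v `` {w}) + card ((joined G v)\<inverse> `` {w}) + 1"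
proof -
  define u where "u = Suc (Max (pverts G))"
  define G' where "G' = attach_leaf G w"
  have V: "pverts G' = insert u (pverts G)" and E: "parcs G' = {(u, w), (w, u)} \<union> parcs G"
    by (simp_all add: G'_def u_def attach_leaf_simps)
  note D = undirected_treeD[OF G]
  have u: "u \<notin> pverts G" unfolding u_def by (rule Suc_Max_notin[OF D(1)])
  define h where "h x = (if x = u then w else x)" for x
  let ?R = "Restr (parcs G) (- {v})"
  have lift: "(h x, h y) \<in> ?R\<^sup>*" if "(x, y) \<in> (Restr (parcs G') (- {v}))\<^sup>*" for x y
    using that
  proof induction
    case (step y z)
    have "h y = h z \<or> (h y, h z) \<in> ?R"
      using step.hyps(2) u w D(3) unfolding E h_def by auto
    with step.IH show ?case by (auto intro: rtrancl_into_rtrancl)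
  qed simp
  \<comment> \<open>For \<open>w = v\<close> the leaf becomes isolated: no arc of \<open>?R\<close>
    meets \<open>v\<close>, so the leaf is paired only with itself.\<close>
  have v_out: "y = v" if "(v, y) \<in> ?R\<^sup>*" for y
    using that by (rule converse_rtranclE) auto
  have v_in: "y = v" if "(y, v) \<in> ?R\<^sup>*" for y
    using that by (rule rtranclE) auto
  have sub: "joined G' v \<subseteq> joined G v \<union> {u} \<times> (joined G v `` {w}) \<union> ((joined G v)\<inverse> `` {w}) \<times> {u} \<union> {(u, u)}"
  proof
    fix p assume "p \<in> joined G' v"
    then obtain x y where p: "p = (x, y)" and xy: "x \<in> insert u (pverts G)" "y \<in> insert u (pverts G)"
      "x \<noteq> v" "y \<noteq> v" "(h x, h y) \<in> ?R\<^sup>*"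
      by (auto simp: joined_def V intro: lift)
    have "(w, y) \<in> joined G v" if "x = u" "y \<noteq> u"
      using that xy w v_out[of y] by (auto simp: joined_def h_def)
    moreover have "(x, w) \<in> joined G v" if "x \<noteq> u" "y = u"
      using that xy w v_in[of x] by (auto simp: joined_def h_def)
    moreover have "(x, y) \<in> joined G v" if "x \<noteq> u" "y \<noteq> u"
      using that xy by (auto simp: joined_def h_def)
    ultimately show "p \<in> joined G v \<union> {u} \<times> (joined G v `` {w}) \<union> ((joined G v)\<inverse> `` {w}) \<times> {u} \<union> {(u, u)}"
      unfolding p by auto
  qed
  have fin: "finite (joined G v)" by (rule finite_joined[OF D(1)])
  then have fin': "finite (joined G v `` {w})" "finite ((joined G v)\<inverse> `` {w})"
    by (auto intro: finite_Image)
  have "card (joined G' v) \<le> card (joined G v \<union> {u} \<times> (joined G v `` {w}) \<union> ((joined G v)\<inverse> `` {w}) \<times> {u} \<union> {(u, u)})"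
    by (rule card_mono[OF _ sub]) (use fin fin' in simp)
  also have "\<dots> \<le> card (joined G v) + card ({u} \<times> (joined G v `` {w})) + card (((joined G v)\<inverse> `` {w}) \<times> {u}) + card {(u, u)}"
    by (meson add_le_mono1 card_Un_le le_trans)
  finally show ?thesis by (simp add: G'_def card_cartesian_product)
qed

lemma sum_card_Image:
  assumes "finite A" "finite R" "R \<subseteq> A \<times> B"
  shows "(\<Sum>w\<in>A. card (R `` {w})) = card R"
proof -
  have "(\<Sum>w\<in>A. card (R `` {w})) = card (SIGMA w:A. R `` {w})"
    using assms by (subst card_SigmaI) (auto intro: finite_Image)
  also have "(SIGMA w:A. R `` {w}) = R" using assms(3) by auto
  finally show ?thesis .
qed

text \<open>Without its centre the star has only isolated vertices, so only diagonal pairs are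
  left.\<close>

lemma card_joined_star: "card (joined (star k) 0) \<le> k - 1"
proof -
  have "Restr (parcs (star k)) (- {0}) = {}" by (auto simp: star_def)
  then have "joined (star k) 0 \<subseteq> (\<lambda>x. (x, x)) ` {1..<k}"
    by (auto simp: joined_def star_def)
  then have "card (joined (star k) 0) \<le> card ((\<lambda>x. (x, x)) ` {1..<k})"
    by (intro card_mono) auto
  also have "\<dots> \<le> card {1..<k}" by (rule card_image_le) simp
  finally show ?thesis by simp
qed

section \<open>Splitting a tree into two connected sides\<close>

definition split_by :: "'a pair_pre_digraph \<Rightarrow> 'a set \<Rightarrow> bool" where
  "split_by G A \<longleftrightarrow> A \<subseteq> pverts G \<and> A \<noteq> {} \<and> pverts G - A \<noteq> {} \<and>
     connected_on (parcs G) A \<and> connected_on (parcs G) (pverts G - A)"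

lemma connected_on_imp_joined:
  assumes "connected_on (parcs G) A" "A \<subseteq> pverts G" "v \<notin> A"
  shows "A \<times> A \<subseteq> joined G v"
proof -
  have "(Restr (parcs G) A)\<^sup>* \<subseteq> (Restr (parcs G) (- {v}))\<^sup>*"
    using assms(3) by (intro rtrancl_mono) auto
  then show ?thesis
    using assms by (auto simp: joined_def dest: connected_onD)
qed

text \<open>\<open>v\<close> lies in at most one side. The other side stays connected after deleting
  \<open>v\<close>, so all its ordered pairs are joined.\<close>

lemma card_joined_ge:
  assumes "split_by G A" "finite (pverts G)"
  shows "(card A)\<^sup>2 \<le> card (joined G v) \<or> (card (pverts G - A))\<^sup>2 \<le> card (joined G v)"
proof -
  have "B \<times> B \<subseteq> joined G v \<Longrightarrow> (card B)\<^sup>2 \<le> card (joined G v)" for B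
    using card_mono[OF finite_joined[OF assms(2)], of "B \<times> B" v]
    by (simp add: card_cartesian_product power2_eq_square)
  moreover have "A \<times> A \<subseteq> joined G v \<or> (pverts G - A) \<times> (pverts G - A) \<subseteq> joined G v"
    using assms(1) connected_on_imp_joined[of G A v] connected_on_imp_joined[of G "pverts G - A" v]
    unfolding split_by_def by blast
  ultimately show ?thesis by blast
qed

text \<open>A maximal connected proper subset has a neighbour \<open>b\<close> outside. Adding
  \<open>b\<close> keeps it connected, so by maximality the result is the whole tree and
  \<open>{b}\<close> is the other side.\<close>

lemma ex_split_by:
  assumes G: "undirected_tree G" and "2 \<le> card (pverts G)"
  shows "\<exists>A. split_by G A"
proof -
  note D = undirected_treeD[OF G]
  define S where "S = {A. A \<subset> pverts G \<and> A \<noteq> {} \<and> connected_on (parcs G) A}"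
  obtain x where x: "x \<in> pverts G" using D(2) by blast
  have "pverts G \<noteq> {x}" using assms(2) by auto
  then have "{x} \<in> S" using x by (auto simp: S_def connected_on_def)
  moreover have "finite S"
    by (rule finite_subset[of _ "Pow (pverts G)"]) (auto simp: S_def D(1))
  ultimately obtain A where A: "A \<in> S" and max: "\<And>B. B \<in> S \<Longrightarrow> A \<subseteq> B \<Longrightarrow> A = B"
    using finite_has_maximal[of S] by auto
  have A': "A \<subset> pverts G" "A \<noteq> {}" "connected_on (parcs G) A" using A by (auto simp: S_def)
  have "\<exists>a b. a \<in> A \<and> b \<in> pverts G - A \<and> (a, b) \<in> parcs G"
  proof (rule ccontr)
    assume none: "\<not> (\<exists>a b. a \<in> A \<and> b \<in> pverts G - A \<and> (a, b) \<in> parcs G)"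
    obtain a b where ab: "a \<in> A" "b \<in> pverts G - A" using A' by auto
    have "(a, b) \<in> (Restr (parcs G) (pverts G))\<^sup>*"
      using ab A' by (intro connected_onD[OF D(6)]) auto
    then have "b \<in> A"
      by induction (use ab none in auto)
    then show False using ab by simp
  qed
  then obtain a b where ab: "a \<in> A" "b \<in> pverts G - A" "(a, b) \<in> parcs G" by blast
  have conn: "connected_on (parcs G) (insert b A)"
    by (rule connected_on_insert[OF A'(3) ab(1)]) (use ab D(4) in \<open>auto dest: symD\<close>)
  have "insert b A = pverts G"
  proof (rule ccontr)
    assume "insert b A \<noteq> pverts G"
    then have "insert b A \<in> S" using conn A' ab by (auto simp: S_def)
    then show False using max[of "insert b A"] ab by auto
  qed
  then have "pverts G - A = {b}" using ab by auto
  then have "split_by G A" using A' by (auto simp: split_by_def connected_on_def)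
  then show ?thesis ..
qed

definition grow_side :: "nat pair_pre_digraph \<Rightarrow> nat set \<Rightarrow> nat \<Rightarrow> nat set" where
  "grow_side G A w = (if w \<in> A then insert (Suc (Max (pverts G))) A else A)"

lemma split_by_attach_leaf:
  assumes A: "split_by G A" and fin: "finite (pverts G)" and w: "w \<in> pverts G"
  shows "split_by (attach_leaf G w) (grow_side G A w)"
proof -
  define u where "u = Suc (Max (pverts G))"
  define G' where "G' = attach_leaf G w"
  have V: "pverts G' = insert u (pverts G)" and E: "parcs G' = {(u, w), (w, u)} \<union> parcs G"
    by (simp_all add: G'_def u_def attach_leaf_simps)
  have u: "u \<notin> pverts G" unfolding u_def by (rule Suc_Max_notin[OF fin])
  then have uA: "u \<notin> A" using A by (auto simp: split_by_def)
  have keep: "connected_on (parcs G) B \<Longrightarrow> connected_on (parcs G') B" for B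
    by (rule connected_on_mono) (auto simp: E)
  have ins: "connected_on (parcs G) B \<Longrightarrow> w \<in> B \<Longrightarrow> connected_on (parcs G') (insert u B)" for B
    by (rule connected_on_insert[OF keep]) (auto simp: E)
  have "split_by G' (if w \<in> A then insert u A else A)"
  proof (cases "w \<in> A")
    case True
    have "pverts G' - insert u A = pverts G - A" using u by (auto simp: V)
    then show ?thesis using True A keep ins unfolding split_by_def V by auto
  next
    case False
    have "pverts G' - A = insert u (pverts G - A)" using uA by (auto simp: V)
    then show ?thesis using False A keep ins[of "pverts G - A"] w unfolding split_by_def V by auto
  qed
  then show ?thesis unfolding grow_side_def u_def G'_def .
qed

subsection \<open>Total variation and the attachment kernel\<close>

lemma sum_pmf_le_1: "finite X \<Longrightarrow> (\<Sum>x\<in>X. pmf p x) \<le> 1"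
  by (simp flip: measure_measure_pmf_finite)

lemma TV_nonneg: "0 \<le> TV X p q"
  by (simp add: TV_def sum_nonneg)

lemma TV_le_1:
  assumes "finite X"
  shows "TV X p q \<le> 1"
proof -
  have "(\<Sum>x\<in>X. \<bar>pmf p x - pmf q x\<bar>) \<le> (\<Sum>x\<in>X. pmf p x + pmf q x)"
    by (rule sum_mono) (smt (verit) pmf_nonneg)
  also have "\<dots> \<le> 2"
    using sum_pmf_le_1[OF assms, of p] sum_pmf_le_1[OF assms, of q] by (simp add: sum.distrib)
  finally show ?thesis by (simp add: TV_def)
qed

text \<open>The differences of the masses sum to zero over \<open>X\<close>, so twice their sum over
  \<open>A\<close> equals the sum over \<open>A\<close> minus the sum over the rest, which the
  absolute values bound.\<close>

lemma TV_ge_diff_prob: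
  assumes X: "finite X" "set_pmf p \<subseteq> X" "set_pmf q \<subseteq> X"
  shows "measure_pmf.prob p A - measure_pmf.prob q A \<le> TV X p q"
proof -
  have prob: "measure_pmf.prob r A = (\<Sum>x\<in>A \<inter> X. pmf r x)" if "set_pmf r \<subseteq> X" for r
  proof -
    have "measure_pmf.prob r A = measure_pmf.prob r (A \<inter> X)"
      using that by (intro measure_pmf.finite_measure_eq_AE) (auto simp: AE_measure_pmf_iff)
    then show ?thesis using X(1) by (simp add: measure_measure_pmf_finite)
  qed
  define d where "d x = pmf p x - pmf q x" for x
  have split: "sum f X = sum f (A \<inter> X) + sum f (X - A)" for f :: "'a \<Rightarrow> real"
    using sum.Int_Diff[OF X(1), of f A] by (simp add: Int_commute)
  have "sum d X = 0"
    using X by (simp add: d_def sum_subtractf sum_pmf_eq_1)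
  then have "2 * sum d (A \<inter> X) = sum d (A \<inter> X) + sum (\<lambda>x. - d x) (X - A)"
    using split[of d] by (simp add: sum_negf)
  also have "\<dots> \<le> sum (\<lambda>x. \<bar>d x\<bar>) (A \<inter> X) + sum (\<lambda>x. \<bar>d x\<bar>) (X - A)"
    by (intro add_mono sum_mono) auto
  also have "\<dots> = sum (\<lambda>x. \<bar>d x\<bar>) X"
    by (simp add: split)
  finally show ?thesis
    by (simp add: TV_def prob X(2,3) d_def sum_subtractf)
qed

lemma pmf_bind_finite:
  assumes "finite X" "set_pmf p \<subseteq> X"
  shows "pmf (bind_pmf p K) y = (\<Sum>x\<in>X. pmf p x * pmf (K x) y)"
  unfolding pmf_bind using assms
  by (subst integral_measure_pmf[of X]) (auto simp: set_pmf_iff)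

text \<open>One kernel applied to both laws cannot separate them further: triangle inequality,
  interchange of sums, and mass at most 1 of each \<open>K x\<close> on \<open>Y\<close>.\<close>

lemma TV_bind_le:
  assumes X: "finite X" "set_pmf p \<subseteq> X" "set_pmf q \<subseteq> X" and Y: "finite Y"
  shows "TV Y (bind_pmf p K) (bind_pmf q K) \<le> TV X p q"
proof -
  have "(\<Sum>y\<in>Y. \<bar>pmf (bind_pmf p K) y - pmf (bind_pmf q K) y\<bar>)
      = (\<Sum>y\<in>Y. \<bar>\<Sum>x\<in>X. (pmf p x - pmf q x) * pmf (K x) y\<bar>)"
    using X by (simp add: pmf_bind_finite sum_subtractf left_diff_distrib)
  also have "\<dots> \<le> (\<Sum>y\<in>Y. \<Sum>x\<in>X. \<bar>pmf p x - pmf q x\<bar> * pmf (K x) y)"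
    by (intro sum_mono order.trans[OF sum_abs]) (simp add: abs_mult)
  also have "\<dots> = (\<Sum>x\<in>X. \<bar>pmf p x - pmf q x\<bar> * (\<Sum>y\<in>Y. pmf (K x) y))"
    by (subst sum.swap) (simp add: sum_distrib_left)
  also have "\<dots> \<le> (\<Sum>x\<in>X. \<bar>pmf p x - pmf q x\<bar> * 1)"
    by (intro sum_mono mult_left_mono sum_pmf_le_1[OF Y]) auto
  finally show ?thesis by (simp add: TV_def)
qed

lemma markov_pmf:
  assumes "(\<integral>\<^sup>+x. ennreal (f x) \<partial>measure_pmf p) \<le> ennreal B" "0 \<le> B" "0 < t"
  shows "measure_pmf.prob p {x. t \<le> f x} \<le> B / t"
proof -
  \<comment> \<open>\<open>ennreal\<close> maps negative values of \<open>f\<close> to 0; as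
    \<open>t\<close> is positive, such points lie outside both sets.\<close>
  have "{x. t \<le> f x} = {x \<in> UNIV. 1 \<le> ennreal (1 / t) * ennreal (f x)}"
  proof -
    have "ennreal (1 / t) * ennreal (f x) = ennreal (f x / t)" for x
      using assms(3) by (simp flip: ennreal_mult')
    then show ?thesis using assms(3) by (simp add: ennreal_ge_1 le_divide_eq)
  qed
  then have "emeasure (measure_pmf p) {x. t \<le> f x} \<le> ennreal (1 / t) * (\<integral>\<^sup>+x. ennreal (f x) * indicator UNIV x \<partial>measure_pmf p)"
    using nn_integral_Markov_inequality[of "\<lambda>x. ennreal (f x)" UNIV "measure_pmf p" "ennreal (1 / t)"] by simp
  also have "\<dots> \<le> ennreal (1 / t) * ennreal B"
    using assms(1) by (intro mult_left_mono) auto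
  also have "\<dots> = ennreal (B / t)"
    using assms(2,3) by (simp flip: ennreal_mult)
  finally show ?thesis
    using assms(2,3) by (simp add: measure_pmf.emeasure_eq_measure)
qed

section \<open>The attachment step on isomorphism classes\<close>

lemma set_pmf_ua_step:
  assumes "undirected_tree G"
  shows "set_pmf (ua_step G) = attach_leaf G ` pverts G"
  using undirected_treeD(1,2)[OF assms] by (simp add: ua_step_def)

text \<open>Keeping the vertices of the seed ensures that the centre \<open>0\<close> of a star
  persists in all later trees.\<close>

lemma ua_iter_support:
  assumes S: "undirected_tree S" and "G \<in> set_pmf (ua_iter m S)"
  shows "undirected_tree G \<and> card (pverts G) = card (pverts S) + m \<and> pverts S \<subseteq> pverts G"
  using assms(2)
proof (induction m arbitrary: G)
  case 0
  then show ?case using S by simp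
next
  case (Suc m)
  then obtain H where H: "H \<in> set_pmf (ua_iter m S)" "G \<in> set_pmf (ua_step H)" by auto
  note IH = Suc.IH[OF H(1)]
  obtain w where w: "w \<in> pverts H" "G = attach_leaf H w"
    using H(2) IH set_pmf_ua_step by blast
  have fin: "finite (pverts H)" using IH undirected_treeD(1) by blast
  have "undirected_tree G" unfolding w(2) by (rule undirected_tree_attach_leaf) (use IH w in auto)
  then show ?case
    using IH fin Suc_Max_notin[OF fin] by (auto simp: w(2) attach_leaf_simps)
qed

lemma set_pmf_UA:
  assumes "undirected_tree S" "card (pverts S) \<le> n"
  shows "set_pmf (UA n S) \<subseteq> unlabelled_trees n"
proof -
  have "G \<in> trees n" if "G \<in> set_pmf (ua_labelled n S)" for G
    using ua_iter_support[OF assms(1)] that assms(2) unfolding ua_labelled_def trees_def by auto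
  then show ?thesis
    by (auto simp: UA_def unlabelled_trees_def intro: quotientI)
qed

text \<open>An isomorphism carries the uniform law on vertices to the uniform law, and attaching at
  corresponding vertices gives isomorphic trees.\<close>

lemma ua_step_iso:
  assumes "(G, H) \<in> tree_iso"
  shows "map_pmf (\<lambda>G. tree_iso `` {G}) (ua_step G) = map_pmf (\<lambda>G. tree_iso `` {G}) (ua_step H)"
proof -
  have tree: "undirected_tree G" and "digraph_iso (with_proj G) (with_proj H)"
    using assms by (auto simp: tree_iso_iff)
  then obtain h where h: "inj_on h (pverts G)" "H = graph_map h G"
    by (elim digraph_isoE)
  note D = undirected_treeD(1,2)[OF tree]
  have "pmf_of_set (pverts H) = map_pmf h (pmf_of_set (pverts G))"
    using map_pmf_of_set_inj[OF h(1) D(2,1)] by (simp add: h(2) graph_map_def)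
  then have "map_pmf (\<lambda>G. tree_iso `` {G}) (ua_step H) =
      map_pmf (\<lambda>v. tree_iso `` {attach_leaf H (h v)}) (pmf_of_set (pverts G))"
    by (simp add: ua_step_def pmf.map_comp o_def)
  also have "\<dots> = map_pmf (\<lambda>v. tree_iso `` {attach_leaf G v}) (pmf_of_set (pverts G))"
  proof (rule map_pmf_cong[OF refl])
    fix v assume "v \<in> set_pmf (pmf_of_set (pverts G))"
    then have "v \<in> pverts G" using D by simp
    then have "(attach_leaf G v, attach_leaf H (h v)) \<in> tree_iso"
      using attach_leaf_iso[OF _ h(1)] assms by (simp add: h(2))
    then show "tree_iso `` {attach_leaf H (h v)} = tree_iso `` {attach_leaf G v}"
      using tree_iso_class_eq by blast
  qed
  finally show ?thesis by (simp add: ua_step_def pmf.map_comp o_def)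
qed

text \<open>The step goes through an arbitrary representative; by \<open>ua_step_iso\<close> the
  choice is immaterial for classes of trees.\<close>

definition ua_kernel :: "nat pair_pre_digraph set \<Rightarrow> nat pair_pre_digraph set pmf" where
  "ua_kernel c = map_pmf (\<lambda>G. tree_iso `` {G}) (ua_step (SOME G. G \<in> c))"

lemma ua_kernel_class:
  assumes "undirected_tree G"
  shows "ua_kernel (tree_iso `` {G}) = map_pmf (\<lambda>G. tree_iso `` {G}) (ua_step G)"
proof -
  have "(SOME H. H \<in> tree_iso `` {G}) \<in> tree_iso `` {G}"
    by (rule someI[of _ G]) (simp add: tree_iso_self assms)
  then have "(G, SOME H. H \<in> tree_iso `` {G}) \<in> tree_iso" by blast
  from ua_step_iso[OF this] show ?thesis by (simp add: ua_kernel_def)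
qed

text \<open>The classes form a Markov chain of their own. \<open>n\<close> is at least the seed
  size, so \<open>Suc n - card (pverts S)\<close> really counts one step more.\<close>

lemma UA_Suc:
  assumes S: "undirected_tree S" and n: "card (pverts S) \<le> n"
  shows "UA (Suc n) S = bind_pmf (UA n S) ua_kernel"
proof -
  have "UA (Suc n) S = bind_pmf (ua_labelled n S) (\<lambda>G. map_pmf (\<lambda>G. tree_iso `` {G}) (ua_step G))"
    using n by (simp add: UA_def ua_labelled_def Suc_diff_le map_bind_pmf)
  also have "\<dots> = bind_pmf (ua_labelled n S) (\<lambda>G. ua_kernel (tree_iso `` {G}))"
    using ua_iter_support[OF S] by (intro bind_pmf_cong refl) (auto simp: ua_labelled_def ua_kernel_class)
  finally show ?thesis by (simp add: UA_def bind_map_pmf)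
qed

lemma TV_UA_decreasing:
  assumes "undirected_tree S" "undirected_tree T" "card (pverts S) \<le> n" "card (pverts T) \<le> n"
  shows "TV (unlabelled_trees (Suc n)) (UA (Suc n) S) (UA (Suc n) T)
    \<le> TV (unlabelled_trees n) (UA n S) (UA n T)"
  using assms by (simp add: UA_Suc TV_bind_le finite_unlabelled_trees set_pmf_UA)

text \<open>\<open>lim\<close> in \<open>delta\<close> is informative only for a convergent
  sequence; convergence follows from monotonicity and nonnegativity.\<close>

lemma TV_UA_tendsto_delta:
  assumes "undirected_tree S" "undirected_tree T"
  shows "(\<lambda>n. TV (unlabelled_trees n) (UA n S) (UA n T)) \<longlonglongrightarrow> delta S T"
proof -
  define f where "f n = TV (unlabelled_trees n) (UA n S) (UA n T)" for n
  \<comment> \<open>From this index on neither step count is truncated, so monotonicity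
    applies.\<close>
  define N where "N = card (pverts S) + card (pverts T)"
  have "decseq (\<lambda>n. f (n + N))"
    by (rule decseq_SucI) (simp add: f_def N_def TV_UA_decreasing assms)
  then have "convergent (\<lambda>n. f (n + N))"
    by (rule decseq_convergent[where B = 0]) (auto simp: f_def TV_nonneg convergentI)
  then have "convergent f" by (simp add: convergent_ignore_initial_segment)
  then show ?thesis
    by (simp add: convergent_LIMSEQ_iff delta_def f_def[abs_def])
qed

section \<open>The existence of a centre as an event on isomorphism classes\<close>

definition has_centre :: "real \<Rightarrow> 'a pair_pre_digraph \<Rightarrow> bool" where
  "has_centre c G \<longleftrightarrow> (\<exists>v\<in>pverts G. real (card (joined G v)) \<le> c)"

lemma has_centre_iso:
  assumes "(G, H) \<in> tree_iso" "has_centre c H"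
  shows "has_centre c G"
proof -
  have tree: "undirected_tree G" and "digraph_iso (with_proj G) (with_proj H)"
    using assms by (auto simp: tree_iso_iff)
  then obtain h where h: "inj_on h (pverts G)" "H = graph_map h G"
    by (elim digraph_isoE)
  obtain v where v: "v \<in> pverts G" "real (card (joined H (h v))) \<le> c"
    using assms(2) by (auto simp: has_centre_def h(2) graph_map_def)
  have "card (joined G v) \<le> card (joined H (h v))"
    unfolding h(2) using undirected_tree_imp_wf[OF tree] undirected_treeD(1)[OF tree] h(1) v(1)
    by (rule card_joined_graph_map)
  then show ?thesis using v by (auto simp: has_centre_def intro!: bexI[of _ v])
qed

text \<open>By invariance, a class almost surely contains a tree with a centre exactly when the
  labelled tree that produced it has one.\<close>

lemma prob_UA_has_centre:
  assumes S: "undirected_tree S"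
  shows "measure_pmf.prob (UA n S) {C. \<exists>G\<in>C. has_centre c G} =
    measure_pmf.prob (ua_labelled n S) {G. has_centre c G}"
proof -
  have "(\<exists>H\<in>tree_iso `` {G}. has_centre c H) \<longleftrightarrow> has_centre c G" if "undirected_tree G" for G
    using has_centre_iso tree_iso_self[OF that] by blast
  then have "AE G in measure_pmf (ua_labelled n S).
      G \<in> (\<lambda>G. tree_iso `` {G}) -` {C. \<exists>G\<in>C. has_centre c G} \<longleftrightarrow> G \<in> {G. has_centre c G}"
    using ua_iter_support[OF S] by (auto simp: AE_measure_pmf_iff ua_labelled_def)
  then show ?thesis
    unfolding UA_def measure_map_pmf by (intro measure_pmf.finite_measure_eq_AE) auto
qed

subsection \<open>Large stars\<close>

text \<open>Vertex \<open>0\<close> is the centre of the star. Adding the number of vertices absorbs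
  the additive terms in the growth of the joined pairs, so the bound for a step becomes purely
  multiplicative.\<close>

definition potential :: "nat pair_pre_digraph \<Rightarrow> real" where
  "potential G = real (card (joined G 0)) + real (card (pverts G))"

lemma potential_nonneg: "0 \<le> potential G"
  by (simp add: potential_def)

lemma ua_step_potential:
  assumes G: "undirected_tree G" and v: "0 \<in> pverts G" and n: "n = real (card (pverts G))"
  shows "(\<integral>\<^sup>+H. ennreal (potential H) \<partial>measure_pmf (ua_step G)) \<le> ennreal ((n + 2) / n * potential G)"
proof -
  note D = undirected_treeD[OF G]
  have n0: "n > 0" using D(1,2) n by (simp add: card_gt_0_iff)
  let ?J = "joined G 0"
  have J: "finite ?J" "?J \<subseteq> pverts G \<times> pverts G" using finite_joined[OF D(1)] by (simp_all add: joined_subset)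
  have "(\<Sum>w\<in>pverts G. potential (attach_leaf G w)) \<le>
      (\<Sum>w\<in>pverts G. real (card ?J) + real (card (?J `` {w})) + real (card (?J\<inverse> `` {w})) + (n + 2))"
  proof (rule sum_mono)
    fix w assume w: "w \<in> pverts G"
    have "card (pverts (attach_leaf G w)) = card (pverts G) + 1"
      using Suc_Max_notin[OF D(1)] D(1) by (simp add: attach_leaf_simps)
    then show "potential (attach_leaf G w) \<le>
        real (card ?J) + real (card (?J `` {w})) + real (card (?J\<inverse> `` {w})) + (n + 2)"
      using card_joined_attach_leaf[OF G v w] by (simp add: potential_def n)
  qed
  \<comment> \<open>Each pair of \<open>?J\<close> is counted once by its first and once by its
    second component. The summand \<open>n + 2\<close> is one new pair plus \<open>n + 1\<close>
    vertices.\<close>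
  also have "\<dots> = n * real (card ?J) + real (card ?J) + real (card (?J\<inverse>)) + n * (n + 2)"
    using sum_card_Image[OF D(1) J] sum_card_Image[of "pverts G" "?J\<inverse>" "pverts G"] D(1) J
    by (simp add: sum.distrib n flip: of_nat_sum) blast
  also have "\<dots> = (n + 2) * potential G"
    by (simp add: potential_def n card_inverse algebra_simps)
  finally have le: "(\<Sum>w\<in>pverts G. potential (attach_leaf G w)) / n \<le> (n + 2) / n * potential G"
    using n0 by (simp add: field_simps)
  have "(\<integral>\<^sup>+H. ennreal (potential H) \<partial>measure_pmf (ua_step G)) =
      ennreal ((\<Sum>w\<in>pverts G. potential (attach_leaf G w)) / n)"
    using D(1,2) n0 n
    by (simp add: ua_step_def nn_integral_pmf_of_set potential_nonneg sum_nonneg divide_ennreal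
        ennreal_of_nat_eq_real_of_nat)
  then show ?thesis using le by (simp add: ennreal_leI)
qed

text \<open>The factors \<open>(i + 2) / i\<close> for \<open>i\<close> from \<open>n\<close> to
  \<open>n + m - 1\<close> telescope.\<close>

lemma ua_iter_potential:
  assumes S: "undirected_tree S" and v: "0 \<in> pverts S" and n: "n = real (card (pverts S))"
  shows "(\<integral>\<^sup>+H. ennreal (potential H) \<partial>measure_pmf (ua_iter m S))
    \<le> ennreal ((n + m) * (n + m + 1) / (n * (n + 1)) * potential S)"
proof (induction m)
  case 0
  have "n > 0" using undirected_treeD(1,2)[OF S] n by (simp add: card_gt_0_iff)
  then show ?case by simp
next
  case (Suc m)
  have n0: "n > 0" using undirected_treeD(1,2)[OF S] n by (simp add: card_gt_0_iff)
  have "(\<integral>\<^sup>+H. ennreal (potential H) \<partial>measure_pmf (ua_iter (Suc m) S)) =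
      (\<integral>\<^sup>+G. (\<integral>\<^sup>+H. ennreal (potential H) \<partial>measure_pmf (ua_step G)) \<partial>measure_pmf (ua_iter m S))"
    by simp
  also have "\<dots> \<le> (\<integral>\<^sup>+G. ennreal ((n + m + 2) / (n + m)) * ennreal (potential G) \<partial>measure_pmf (ua_iter m S))"
  proof (rule nn_integral_mono_AE, unfold AE_measure_pmf_iff, rule ballI)
    fix G assume "G \<in> set_pmf (ua_iter m S)"
    from ua_iter_support[OF S this]
    have "undirected_tree G" "0 \<in> pverts G" "n + m = real (card (pverts G))" using v n by auto
    from ua_step_potential[OF this]
    show "(\<integral>\<^sup>+H. ennreal (potential H) \<partial>measure_pmf (ua_step G)) \<le>
        ennreal ((n + m + 2) / (n + m)) * ennreal (potential G)"
      using n0 by (simp only: ennreal_mult potential_nonneg divide_nonneg_nonneg add_nonneg_nonneg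
        of_nat_0_le_iff less_imp_le zero_le_numeral)
  qed
  also have "\<dots> = ennreal ((n + m + 2) / (n + m)) * (\<integral>\<^sup>+G. ennreal (potential G) \<partial>measure_pmf (ua_iter m S))"
    by (rule nn_integral_cmult) simp
  also have "\<dots> \<le> ennreal ((n + m + 2) / (n + m)) * ennreal ((n + m) * (n + m + 1) / (n * (n + 1)) * potential S)"
    by (intro mult_left_mono Suc.IH) simp
  also have "\<dots> = ennreal ((n + m + 2) / (n + m) * ((n + m) * (n + m + 1) / (n * (n + 1)) * potential S))"
    using n0 by (subst ennreal_mult) (auto simp: potential_def)
  also have "(n + m + 2) / (n + m) * ((n + m) * (n + m + 1) / (n * (n + 1)) * potential S) =
      (n + Suc m) * (n + Suc m + 1) / (n * (n + 1)) * potential S"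
    using n0 by (simp add: divide_simps) (simp add: algebra_simps)
  finally show ?case .
qed

lemma prob_star_has_centre:
  fixes e :: real
  assumes k: "1 \<le> k" "k \<le> n" and e: "0 < e"
  shows "1 - 4 / (k * e\<^sup>2) \<le> measure_pmf.prob (ua_labelled n (star k)) {G. has_centre ((e * n)\<^sup>2) G}"
proof -
  let ?p = "ua_labelled n (star k)"
  note S = undirected_tree_star[OF k(1)]
  have card: "card (pverts (star k)) = k" and z: "0 \<in> pverts (star k)"
    using k by (auto simp: star_def)
  \<comment> \<open>At most \<open>k - 1\<close> joined pairs plus \<open>k\<close>
    vertices.\<close>
  have "potential (star k) \<le> 2 * k - 1"
    using card_joined_star[of k] k by (simp add: potential_def card)
  then have pot: "real n * (n + 1) / (k * (real k + 1)) * potential (star k) \<le> real n * (n + 1) / (k * (real k + 1)) * (2 * k)"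
    by (intro mult_left_mono) auto
  let ?B = "real n * (n + 1) / (k * (real k + 1)) * (2 * k)"
  have "(\<integral>\<^sup>+H. ennreal (potential H) \<partial>measure_pmf ?p) \<le> ennreal (real n * (n + 1) / (k * (real k + 1)) * potential (star k))"
    using ua_iter_potential[OF S z refl, of "n - k"] k by (simp add: ua_labelled_def card ac_simps)
  also have "\<dots> \<le> ennreal ?B" by (rule ennreal_leI[OF pot])
  finally have "measure_pmf.prob ?p {G. (e * n)\<^sup>2 \<le> potential G} \<le> ?B / (e * n)\<^sup>2"
    using k e by (intro markov_pmf) auto
  also have "?B / (e * n)\<^sup>2 = 2 * (n + 1) / ((real k + 1) * n * e\<^sup>2)"
    using k e by (simp add: divide_simps power2_eq_square)
  also have "\<dots> \<le> 4 / (k * e\<^sup>2)"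
  proof -
    have "2 * (real n + 1) * k \<le> 4 * ((real k + 1) * n)"
      using k mult_mono[of "real n + 1" "2 * real n" "real k" "real k + 1"] by (simp add: algebra_simps)
    then have "2 * (real n + 1) * k * e\<^sup>2 \<le> 4 * ((real k + 1) * n) * e\<^sup>2"
      by (rule mult_right_mono) simp
    then show ?thesis using k e by (simp add: divide_simps) (simp add: algebra_simps)
  qed
  finally have bad: "measure_pmf.prob ?p {G. (e * n)\<^sup>2 \<le> potential G} \<le> 4 / (k * e\<^sup>2)" .
  \<comment> \<open>If \<open>0\<close> fails to be a centre, its joined pairs alone exceed the
    threshold.\<close>
  have "AE G in measure_pmf ?p. G \<in> - {G. has_centre ((e * n)\<^sup>2) G} \<longrightarrow> G \<in> {G. (e * n)\<^sup>2 \<le> potential G}"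
    using ua_iter_support[OF S] z
    by (fastforce simp: AE_measure_pmf_iff ua_labelled_def has_centre_def potential_def)
  then have "measure_pmf.prob ?p (- {G. has_centre ((e * n)\<^sup>2) G}) \<le> measure_pmf.prob ?p {G. (e * n)\<^sup>2 \<le> potential G}"
    by (intro measure_pmf.finite_measure_mono_AE) auto
  also note bad
  finally show ?thesis
    using measure_pmf.prob_compl[of "{G. has_centre ((e * n)\<^sup>2) G}" ?p] by (simp add: Compl_eq_Diff_UNIV)
qed

subsection \<open>Fixed seeds\<close>

text \<open>A coupling: the tree grows as before and carries one of its sides along; forgetting the
  side returns \<open>ua_iter\<close>.\<close>

primrec side_iter :: "nat \<Rightarrow> nat pair_pre_digraph \<times> nat set \<Rightarrow> (nat pair_pre_digraph \<times> nat set) pmf" where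
  "side_iter 0 x = return_pmf x"
| "side_iter (Suc m) x = bind_pmf (side_iter m x)
     (\<lambda>(G, A). map_pmf (\<lambda>w. (attach_leaf G w, grow_side G A w)) (pmf_of_set (pverts G)))"

lemma map_fst_side_iter: "map_pmf fst (side_iter m (S, A)) = ua_iter m S"
proof (induction m)
  case (Suc m)
  have "map_pmf fst (side_iter (Suc m) (S, A)) = bind_pmf (map_pmf fst (side_iter m (S, A))) ua_step"
    by (simp add: map_bind_pmf bind_map_pmf ua_step_def pmf.map_comp o_def case_prod_beta)
  then show ?case by (simp add: Suc.IH)
qed simp

lemma side_iter_support:
  assumes S: "undirected_tree S" "split_by S A" and "(G, B) \<in> set_pmf (side_iter m (S, A))"
  shows "undirected_tree G \<and> split_by G B \<and> card (pverts G) = card (pverts S) + m"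
proof -
  have "G \<in> set_pmf (map_pmf fst (side_iter m (S, A)))" using assms(3) by force
  then have "undirected_tree G \<and> card (pverts G) = card (pverts S) + m"
    using ua_iter_support[OF S(1)] by (simp add: map_fst_side_iter)
  moreover have "split_by G B" using assms(3)
  proof (induction m arbitrary: G B)
    case 0
    then show ?case using S by simp
  next
    case (Suc m)
    then obtain H C where HC: "(H, C) \<in> set_pmf (side_iter m (S, A))"
      and GB: "(G, B) \<in> set_pmf (map_pmf (\<lambda>w. (attach_leaf H w, grow_side H C w)) (pmf_of_set (pverts H)))"
      by auto
    have "H \<in> set_pmf (map_pmf fst (side_iter m (S, A)))" using HC by force
    then have "undirected_tree H"
      using ua_iter_support[OF S(1)] by (simp add: map_fst_side_iter)
    note D = undirected_treeD(1,2)[OF this]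
    then show ?case using GB split_by_attach_leaf[OF Suc.IH[OF HC]] by auto
  qed
  ultimately show ?thesis by blast
qed

lemma split_by_card:
  assumes "split_by G A" "finite (pverts G)"
  shows "1 \<le> card A" "card A < card (pverts G)" "card (pverts G - A) = card (pverts G) - card A"
proof -
  have A: "A \<subseteq> pverts G" "A \<noteq> {}" "A \<noteq> pverts G" using assms(1) by (auto simp: split_by_def)
  then have fin: "finite A" using assms(2) finite_subset by blast
  then show "1 \<le> card A" using A by (simp add: Suc_le_eq card_gt_0_iff)
  show "card A < card (pverts G)" using A assms(2) by (intro psubset_card_mono) auto
  show "card (pverts G - A) = card (pverts G) - card A" using A fin by (simp add: card_Diff_subset)
qed

text \<open>Size \<open>j\<close> is reached from \<open>j - 1\<close> when the parent lies in the
  side, and kept when the parent lies outside.\<close>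

lemma side_step_pmf:
  assumes G: "undirected_tree G" "split_by G A" and n: "n = card (pverts G)" and j: "1 \<le> j" "j \<le> n"
  shows "pmf (map_pmf (\<lambda>w. card (grow_side G A w)) (pmf_of_set (pverts G))) j =
    real (j - 1) / n * of_bool (card A = j - 1) + real (n - j) / n * of_bool (card A = j)"
proof -
  note D = undirected_treeD(1,2)[OF G(1)]
  have A: "A \<subseteq> pverts G" using G(2) by (simp add: split_by_def)
  have fin: "finite A" using A D(1) finite_subset by blast
  have grow: "card (grow_side G A w) = (if w \<in> A then Suc (card A) else card A)" for w
    using Suc_Max_notin[OF D(1)] A fin by (simp add: grow_side_def card_insert_if subset_iff) blast
  \<comment> \<open>Since \<open>1 \<le> j\<close>, the truncated \<open>j - 1\<close> differs from
    \<open>j\<close> and the cases exclude each other.\<close>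
  have "pverts G \<inter> (\<lambda>w. card (grow_side G A w)) -` {j} =
      (if card A = j - 1 then A else if card A = j then pverts G - A else {})"
    using A j by (auto simp: grow)
  then have "card (pverts G \<inter> (\<lambda>w. card (grow_side G A w)) -` {j}) =
      (if card A = j - 1 then j - 1 else if card A = j then n - j else 0)"
    using split_by_card(3)[OF G(2) D(1)] n by auto
  then show ?thesis
    using j by (auto simp: pmf_map measure_pmf_of_set[OF D(2,1)] n)
qed

text \<open>If \<open>p\<close> is the law of the size of the side in a tree on \<open>N\<close> vertices, the next law at \<open>j\<close> is
  \<open>p (j - 1) * (j - 1) / N + p j * (N - j) / N\<close>. The weights sum to \<open>(N - 1) / N\<close>, so the maximum of
  the law shrinks at least by this factor.\<close>

lemma side_iter_pmf_le:
  assumes S: "undirected_tree S" "split_by S A" and n: "n = card (pverts S)"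
  shows "pmf (map_pmf (\<lambda>x. card (snd x)) (side_iter m (S, A))) j \<le> (real n - 1) / (real n + m - 1)"
proof (induction m arbitrary: j)
  case 0
  \<comment> \<open>This makes the bound \<open>1\<close> at \<open>m = 0\<close>; for
    \<open>n = 1\<close> the quotient would be \<open>0 / 0 = 0\<close>.\<close>
  have "n \<ge> 2" using split_by_card[OF S(2) undirected_treeD(1)[OF S(1)]] n by linarith
  then show ?case by (simp add: pmf_le_1)
next
  case (Suc m)
  have n2: "n \<ge> 2" using split_by_card[OF S(2) undirected_treeD(1)[OF S(1)]] n by linarith
  let ?q = "\<lambda>m. map_pmf (\<lambda>x. card (snd x)) (side_iter m (S, A))"
  let ?N = "n + m"
  show ?case
  proof (cases "1 \<le> j \<and> j \<le> ?N")
    \<comment> \<open>After \<open>Suc m\<close> steps there are \<open>?N + 1\<close> vertices and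
      both sides are nonempty, so the tracked side has between \<open>1\<close> and
      \<open>?N\<close> of them.\<close>
    case False
    have "j \<notin> set_pmf (?q (Suc m))"
    proof
      assume "j \<in> set_pmf (?q (Suc m))"
      then obtain G B where GB: "(G, B) \<in> set_pmf (side_iter (Suc m) (S, A))" "j = card B"
        unfolding set_map_pmf by force
      have "undirected_tree G" "split_by G B" "card (pverts G) = n + Suc m"
        using side_iter_support[OF S GB(1)] n by auto
      then show False using split_by_card[of G B] undirected_treeD(1)[of G] GB(2) False by simp
    qed
    then have "pmf (?q (Suc m)) j = 0" by (simp only: pmf_eq_0_set_pmf not_False_eq_True)
    then show ?thesis using n2 by simp
  next
    case True
    define P where "P i = measure_pmf.prob (side_iter m (S, A)) {x. card (snd x) = i}" for i
    have P: "P i = pmf (?q m) i" for i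
      by (simp add: P_def pmf_map vimage_def)
    have "pmf (?q (Suc m)) j = pmf (bind_pmf (side_iter m (S, A))
        (\<lambda>x. map_pmf (\<lambda>w. card (grow_side (fst x) (snd x) w)) (pmf_of_set (pverts (fst x))))) j"
      by (simp add: map_bind_pmf pmf.map_comp o_def case_prod_beta)
    also have "\<dots> = (LINT x|side_iter m (S, A).
        pmf (map_pmf (\<lambda>w. card (grow_side (fst x) (snd x) w)) (pmf_of_set (pverts (fst x)))) j)"
      by (rule pmf_bind)
    also have "\<dots> = (LINT x|side_iter m (S, A). real (j - 1) / ?N * indicator {x. card (snd x) = j - 1} x
        + real (?N - j) / ?N * indicator {x. card (snd x) = j} x)"
    proof (rule integral_cong_AE; (simp only: AE_measure_pmf_iff)?)
      show "\<forall>x\<in>set_pmf (side_iter m (S, A)).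
          pmf (map_pmf (\<lambda>w. card (grow_side (fst x) (snd x) w)) (pmf_of_set (pverts (fst x)))) j =
          real (j - 1) / ?N * indicator {x. card (snd x) = j - 1} x + real (?N - j) / ?N * indicator {x. card (snd x) = j} x"
      proof
        fix x assume x: "x \<in> set_pmf (side_iter m (S, A))"
        have "undirected_tree (fst x)" "split_by (fst x) (snd x)" "?N = card (pverts (fst x))"
          using side_iter_support[OF S, of "fst x" "snd x" m] x n by auto
        from side_step_pmf[OF this] True
        show "pmf (map_pmf (\<lambda>w. card (grow_side (fst x) (snd x) w)) (pmf_of_set (pverts (fst x)))) j =
          real (j - 1) / ?N * indicator {x. card (snd x) = j - 1} x + real (?N - j) / ?N * indicator {x. card (snd x) = j} x"
          by (simp add: indicator_def)
      qed
    qed simp_all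
    also have "\<dots> = real (j - 1) / ?N * P (j - 1) + real (?N - j) / ?N * P j"
      unfolding P_def
      by (subst Bochner_Integration.integral_add)
        (auto intro!: measure_pmf.integrable_const_bound[where B = 1] integrable_mult_right
          simp del: times_divide_eq_left)
    also have "\<dots> \<le> real (j - 1) / ?N * ((real n - 1) / (real n + m - 1)) + real (?N - j) / ?N * ((real n - 1) / (real n + m - 1))"
      unfolding P by (intro add_mono mult_left_mono Suc.IH) auto
    \<comment> \<open>The weights add up to \<open>(?N - 1) / ?N\<close>, and \<open>?N - 1\<close>
      cancels against the denominator of the old bound.\<close>
    also have "\<dots> = (real n - 1) / (real n + Suc m - 1)"
      using n2 True by (simp add: divide_simps of_nat_diff) (simp add: algebra_simps)
    finally show ?thesis .
  qed
qed

lemma card_nat_interval_le: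
  assumes "0 \<le> x"
  shows "real (card {j::nat. 1 \<le> j \<and> real j \<le> x}) \<le> x" "finite {j::nat. 1 \<le> j \<and> real j \<le> x}"
proof -
  have "{j::nat. 1 \<le> j \<and> real j \<le> x} = {1..nat \<lfloor>x\<rfloor>}"
    using assms by (auto simp: le_nat_iff le_floor_iff)
  then show "real (card {j::nat. 1 \<le> j \<and> real j \<le> x}) \<le> x" "finite {j::nat. 1 \<le> j \<and> real j \<le> x}"
    using assms by auto
qed

text \<open>A centre forces one side to have at most \<open>e * n\<close> vertices. That leaves at
  most \<open>2 * e * n\<close> sizes for the tracked side, each of probability at most
  \<open>(m - 1) / (n - 1)\<close>.\<close>

lemma prob_has_centre_le:
  fixes e :: real
  assumes S: "undirected_tree S" "2 \<le> card (pverts S)" and m: "m = card (pverts S)" "m \<le> n" and e: "0 < e"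
  shows "measure_pmf.prob (ua_labelled n S) {G. has_centre ((e * n)\<^sup>2) G} \<le> 4 * e * m"
proof -
  obtain A where A: "split_by S A" using ex_split_by[OF S] by blast
  let ?p = "side_iter (n - m) (S, A)"
  define small where "small = {j::nat. 1 \<le> j \<and> real j \<le> e * n}"
  have small: "real (card small) \<le> e * n" "finite small"
    using card_nat_interval_le[of "e * n"] e unfolding small_def by auto
  \<comment> \<open>Sizes for which the tracked side or its complement is small. For
    \<open>j > n\<close> the truncated difference is \<open>0\<close>, which can only enlarge the
    event.\<close>
  define ends where "ends = small \<union> (\<lambda>j. n - j) ` small"
  have "card ends \<le> card small + card small"
    unfolding ends_def using card_Un_le card_image_le[OF small(2)] by (meson add_left_mono le_trans)
  then have ends: "real (card ends) \<le> 2 * e * n" "finite ends"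
    using small unfolding ends_def by auto
  have "measure_pmf.prob (ua_labelled n S) {G. has_centre ((e * n)\<^sup>2) G} =
      measure_pmf.prob ?p {x. has_centre ((e * n)\<^sup>2) (fst x)}"
    unfolding ua_labelled_def m(1)[symmetric] map_fst_side_iter[of "n - m" S A, symmetric]
    by (simp add: vimage_def)
  also have "\<dots> \<le> measure_pmf.prob ?p {x. card (snd x) \<in> ends}"
  proof (rule measure_pmf.finite_measure_mono_AE, unfold AE_measure_pmf_iff, safe)
    fix G B assume GB: "(G, B) \<in> set_pmf ?p" and c: "has_centre ((e * n)\<^sup>2) (fst (G, B))"
    have G: "undirected_tree G" "split_by G B" "card (pverts G) = n"
      using side_iter_support[OF S(1) A GB] m by auto
    note fin = undirected_treeD(1)[OF G(1)]
    note cd = split_by_card[OF G(2) fin]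
    obtain v where v: "real (card (joined G v)) \<le> (e * n)\<^sup>2" using c by (auto simp: has_centre_def)
    have sq: "real i \<le> e * n" if "i\<^sup>2 \<le> card (joined G v)" for i
    proof -
      have "(real i)\<^sup>2 \<le> real (card (joined G v))" using that by (metis of_nat_mono of_nat_power)
      then have "(real i)\<^sup>2 \<le> (e * n)\<^sup>2" using v by linarith
      then show ?thesis by (rule power2_le_imp_le) (use e in simp)
    qed
    have "card B \<in> small \<or> n - card B \<in> small"
      using card_joined_ge[OF G(2) fin, of v] sq[of "card B"] sq[of "card (pverts G - B)"] cd(1,2)
      unfolding cd(3) G(3) small_def by auto
    moreover have "card B = n - (n - card B)" using cd G(3) by simp
    ultimately show "card (snd (G, B)) \<in> ends" unfolding ends_def by auto
  qed simp
  also have "\<dots> = (\<Sum>j\<in>ends. pmf (map_pmf (\<lambda>x. card (snd x)) ?p) j)"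
    using ends(2) by (simp add: vimage_def flip: measure_measure_pmf_finite)
  also have "\<dots> \<le> (\<Sum>j\<in>ends. (real m - 1) / (real m + (n - m) - 1))"
    by (intro sum_mono side_iter_pmf_le[OF S(1) A m(1), of "n - m", THEN order_trans]) simp
  also have "\<dots> = real (card ends) * ((real m - 1) / (real n - 1))"
    using m by simp
  also have "\<dots> \<le> 2 * e * n * ((real m - 1) / (real n - 1))"
    using ends(1) m S(2) by (intro mult_right_mono) auto
  also have "\<dots> = 2 * e * (real m - 1) * (n / (real n - 1))" by simp
  \<comment> \<open>\<open>n / (n - 1) \<le> 2\<close> because \<open>n \<ge> 2\<close>.\<close>
  also have "\<dots> \<le> 2 * e * m * 2"
    using m S(2) e by (intro mult_mono) (auto simp: field_simps)
  finally show ?thesis by simp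
qed

section \<open>Bounds on the limit distance\<close>

lemma delta_star_ge:
  fixes e :: real
  assumes T: "undirected_tree T" "2 \<le> card (pverts T)" and k: "1 \<le> k" and e: "0 < e"
  shows "1 - 4 / (k * e\<^sup>2) - 4 * e * card (pverts T) \<le> delta (star k) T"
proof (rule LIMSEQ_le_const[OF TV_UA_tendsto_delta[OF undirected_tree_star[OF k] T(1)]])
  show "\<exists>N. \<forall>n\<ge>N. 1 - 4 / (k * e\<^sup>2) - 4 * e * card (pverts T) \<le> TV (unlabelled_trees n) (UA n (star k)) (UA n T)"
  proof (intro exI allI impI)
    \<comment> \<open>The event of having a centre separates the two laws by an amount independent
      of \<open>n\<close>, so the bound passes to the limit.\<close>
    fix n assume "k + card (pverts T) \<le> n"
    then have n: "k \<le> n" "card (pverts T) \<le> n" by auto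
    have "card (pverts (star k)) = k" by (simp add: star_def)
    then have supp: "set_pmf (UA n (star k)) \<subseteq> unlabelled_trees n" "set_pmf (UA n T) \<subseteq> unlabelled_trees n"
      using set_pmf_UA undirected_tree_star[OF k] T(1) n by auto
    show "1 - 4 / (k * e\<^sup>2) - 4 * e * card (pverts T) \<le> TV (unlabelled_trees n) (UA n (star k)) (UA n T)"
      using TV_ge_diff_prob[OF finite_unlabelled_trees supp, of "{C. \<exists>G\<in>C. has_centre ((e * n)\<^sup>2) G}"]
        prob_star_has_centre[OF k n(1) e] prob_has_centre_le[OF T refl n(2) e]
        prob_UA_has_centre[OF undirected_tree_star[OF k]] prob_UA_has_centre[OF T(1)]
      by simp
  qed
qed

lemma delta_le_1:
  assumes "undirected_tree S" "undirected_tree T"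
  shows "delta S T \<le> 1"
  by (rule LIMSEQ_le_const2[OF TV_UA_tendsto_delta[OF assms]])
    (auto intro: TV_le_1 finite_unlabelled_trees)

theorem theorem2:
  fixes T :: "nat pair_pre_digraph"
  assumes "undirected_tree T" and "2 \<le> card (pverts T)"
  shows "(\<lambda>k. delta (star k) T) \<longlonglongrightarrow> 1"
proof (rule tendsto_sandwich)
  define m where "m = real (card (pverts T))"
  \<comment> \<open>This exponent balances the two errors: \<open>4 / (k * (e k)\<^sup>2)\<close>
    and \<open>4 * e k * m\<close> are both of order \<open>k powr (- 1 / 3)\<close>.\<close>
  define e where "e k = real k powr (- 1 / 3)" for k
  show "\<forall>\<^sub>F k in sequentially. 1 - 4 / (k * (e k)\<^sup>2) - 4 * e k * m \<le> delta (star k) T"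
    using eventually_ge_at_top[of 1]
    by eventually_elim (simp add: m_def e_def delta_star_ge[OF assms])
  show "\<forall>\<^sub>F k in sequentially. delta (star k) T \<le> 1"
    using eventually_ge_at_top[of 1]
    by eventually_elim (simp add: delta_le_1 undirected_tree_star assms)
  show "(\<lambda>k. 1 - 4 / (k * (e k)\<^sup>2) - 4 * e k * m) \<longlonglongrightarrow> 1"
    unfolding e_def by real_asymp
qed simp

end
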